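(* Let $d\ge 3$ be an integer, let $G$ be a $C_5$-free graph of maximum degree $d$, and let $M$ be an induced matching of $G$ produced by applying Local Search to $G$. Then the following statements hold. (i) Let $xy$ be an edge in $M$. Let $N_1$ be the set of vertices in $(N_G(x)\cup N_G(y))\setminus\{x,y\}$ that are incident with an edge in $PC_G(M,xy)$, and let $N_2$ be the set of vertices in $V(G)\setminus(N_G[x]\cup N_G[y])$ that are incident with an edge in $PC_G(M,xy)$. Then there exist non-negative integers $d_x$, $d_{xy}$, and $d_y$ with $d_x+d_{xy}\leq d-1$, $d_y+d_{xy}\leq d-1$, and $d_{xy}\leq n_{xy}$ such that $$m_G(N_1,N_2)\leq(d-1-d_y)d_x+(d-2)d_{xy}+(d-1-d_x)d_y.$$ (ii) $|M|\geq\dfrac{m(G)}{\frac{3}{2}d^2-d+\frac{1}{2}}$.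
   Context: Graphs are finite, simple, and undirected; $V(G)$, $E(G)$ are the vertex and edge sets and $m(G)=|E(G)|$. $N_G(u)$ is the neighborhood of $u$ and $N_G[u]=\{u\}\cup N_G(u)$. For an edge $xy$ of $G$, $n_{xy}=|N_G(x)\cap N_G(y)|$. For disjoint sets $X,Y\subseteq V(G)$, $m_G(X,Y)$ is the number of edges $uv$ of $G$ with $u\in X$ and $v\in Y$. $C_5$ is the cycle of order $5$; $G$ is $C_5$-free if it contains no $C_5$ as an induced subgraph. A set $M\subseteq E(G)$ is an induced matching of $G$ if the subgraph of $G$ induced by the set of vertices incident with edges in $M$ is $1$-regular (the empty set is an induced matching). For an edge $e$ of $G$, $C_G(e)=\{f\in E(G):\mathrm{dist}_{L(G)}(e,f)\leq 2\}$, where $L(G)$ is the line graph of $G$ (so $C_G(e)$ consists of $e$, all edges sharing a vertex with $e$, and all edges joined to $e$ by an edge of $G$). For a set $M$ of edges and $e\in M$, $PC_G(M,e)=C_G(e)\setminus\bigcup_{f\in M\setminus\{e\}}C_G(f)$. Local Search is the following algorithm on input $G$: start with $M=\emptyset$ and repeat the following iteration: (1) if $M\cup\{e\}$ is an induced matching of $G$ for some edge $e\in E(G)\setminus M$, replace $M$ by $M\cup\{e\}$; (2) if $(M\setminus\{e\})\cup\{e',e''\}$ is an induced matching of $G$ for some three distinct edges $e\in M$ and $e',e''\in E(G)\setminus M$, replace $M$ by $(M\setminus\{e\})\cup\{e',e''\}$. The choices are arbitrary. Stop when $|M|$ does not increase during one iteration (i.e. neither (1) nor (2) is possible), and return $M$.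 *)

theory Defs
  imports Complex_Main "HOL-Library.Extended_Nat"
begin

record 'a ugraph =
  verts :: "'a set"
  edges :: "'a set set"

definition finite_simple_graph :: "'a ugraph \<Rightarrow> bool" where
  "finite_simple_graph G \<longleftrightarrow>
     finite (verts G) \<and> (\<forall>e \<in> edges G. e \<subseteq> verts G \<and> card e = 2)"

definition nbhd :: "'a ugraph \<Rightarrow> 'a \<Rightarrow> 'a set" where
  "nbhd G u = {v \<in> verts G. {u, v} \<in> edges G}"

definition closed_nbhd :: "'a ugraph \<Rightarrow> 'a \<Rightarrow> 'a set" where
  "closed_nbhd G u = insert u (nbhd G u)"

definition degree :: "'a ugraph \<Rightarrow> 'a \<Rightarrow> nat" where
  "degree G u = card (nbhd G u)"

(* The inserted 0 only matters for the graph without vertices. *)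
definition max_degree :: "'a ugraph \<Rightarrow> nat" where
  "max_degree G = Max (insert 0 (degree G ` verts G))"

definition regular :: "nat \<Rightarrow> 'a ugraph \<Rightarrow> bool" where
  "regular k G \<longleftrightarrow> (\<forall>u \<in> verts G. degree G u = k)"

definition num_common_nbrs :: "'a ugraph \<Rightarrow> 'a \<Rightarrow> 'a \<Rightarrow> nat" where
  "num_common_nbrs G x y = card (nbhd G x \<inter> nbhd G y)"

definition num_edges_between :: "'a ugraph \<Rightarrow> 'a set \<Rightarrow> 'a set \<Rightarrow> nat" where
  "num_edges_between G X Y = card {e \<in> edges G. \<exists>u \<in> X. \<exists>v \<in> Y. e = {u, v}}"

definition induced_subgraph :: "'a ugraph \<Rightarrow> 'a set \<Rightarrow> 'a ugraph" where
  "induced_subgraph G S = \<lparr>verts = S, edges = {e \<in> edges G. e \<subseteq> S}\<rparr>"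

definition isomorphic :: "'a ugraph \<Rightarrow> 'b ugraph \<Rightarrow> bool" where
  "isomorphic G H \<longleftrightarrow>
     (\<exists>f. bij_betw f (verts G) (verts H) \<and>
       (\<forall>u \<in> verts G. \<forall>v \<in> verts G. {u, v} \<in> edges G \<longleftrightarrow> {f u, f v} \<in> edges H))"

definition induced_free :: "'b ugraph \<Rightarrow> 'a ugraph \<Rightarrow> bool" where
  "induced_free H G \<longleftrightarrow> \<not> (\<exists>S \<subseteq> verts G. isomorphic (induced_subgraph G S) H)"

(* This is a cycle only for orders at least 3. *)
definition cycle_graph :: "nat \<Rightarrow> nat ugraph" where
  "cycle_graph n = \<lparr>verts = {..<n}, edges = {{i, Suc i mod n} | i. i < n}\<rparr>"

definition line_graph :: "'a ugraph \<Rightarrow> 'a set ugraph" where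
  "line_graph G =
     \<lparr>verts = edges G,
      edges = {{e, f} | e f. e \<in> edges G \<and> f \<in> edges G \<and> e \<noteq> f \<and> e \<inter> f \<noteq> {}}\<rparr>"

definition walk_betw :: "'a ugraph \<Rightarrow> 'a \<Rightarrow> 'a list \<Rightarrow> 'a \<Rightarrow> bool" where
  "walk_betw G u p v \<longleftrightarrow>
     p \<noteq> [] \<and> hd p = u \<and> last p = v \<and> set p \<subseteq> verts G \<and>
     successively (\<lambda>a b. {a, b} \<in> edges G) p"

(* The distance is infinite if there is no walk from u to v. *)
definition graph_dist :: "'a ugraph \<Rightarrow> 'a \<Rightarrow> 'a \<Rightarrow> enat" where
  "graph_dist G u v = (INF p \<in> {p. walk_betw G u p v}. enat (length p - 1))"

definition conflict_set :: "'a ugraph \<Rightarrow> 'a set \<Rightarrow> 'a set set" where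
  "conflict_set G e = {f \<in> edges G. graph_dist (line_graph G) e f \<le> 2}"

definition private_conflict_set :: "'a ugraph \<Rightarrow> 'a set set \<Rightarrow> 'a set \<Rightarrow> 'a set set" where
  "private_conflict_set G M e = conflict_set G e - (\<Union>f \<in> M - {e}. conflict_set G f)"

definition induced_matching :: "'a ugraph \<Rightarrow> 'a set set \<Rightarrow> bool" where
  "induced_matching G M \<longleftrightarrow> M \<subseteq> edges G \<and> regular 1 (induced_subgraph G (\<Union>M))"

definition ls_add :: "'a ugraph \<Rightarrow> 'a set set \<Rightarrow> 'a set set \<Rightarrow> bool" where
  "ls_add G M M' \<longleftrightarrow>
     (\<exists>e \<in> edges G - M. M' = M \<union> {e} \<and> induced_matching G M')"

definition ls_swap :: "'a ugraph \<Rightarrow> 'a set set \<Rightarrow> 'a set set \<Rightarrow> bool" where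
  "ls_swap G M M' \<longleftrightarrow>
     (\<exists>e \<in> M. \<exists>e' \<in> edges G - M. \<exists>e'' \<in> edges G - M.
        e' \<noteq> e'' \<and> M' = (M - {e}) \<union> {e', e''} \<and> induced_matching G M')"

definition perform_if_possible :: "('s \<Rightarrow> 's \<Rightarrow> bool) \<Rightarrow> 's \<Rightarrow> 's \<Rightarrow> bool" where
  "perform_if_possible r s s' \<longleftrightarrow> r s s' \<or> (\<nexists>t. r s t) \<and> s' = s"

definition ls_iteration :: "'a ugraph \<Rightarrow> 'a set set \<Rightarrow> 'a set set \<Rightarrow> bool" where
  "ls_iteration G M M' \<longleftrightarrow>
     (\<exists>N. perform_if_possible (ls_add G) M N \<and> perform_if_possible (ls_swap G) N M')"

(* Since the choices are arbitrary, this is the set of all possible outputs.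
   Both kinds of replacement increase the cardinality of M, so an iteration leaves
   it unchanged exactly if neither of them is possible. *)
definition local_search_output :: "'a ugraph \<Rightarrow> 'a set set \<Rightarrow> bool" where
  "local_search_output G M \<longleftrightarrow>
     (ls_iteration G)\<^sup>*\<^sup>* {} M \<and> (\<nexists>M'. ls_add G M M') \<and> (\<nexists>M'. ls_swap G M M')"

end

theory Submission
  imports Defs
begin

text \<open>
  The output M of Local Search is a local optimum, and that is all the proof uses. No edge can be
  added, so every edge of G conflicts with some edge of M. No edge of M can be exchanged for two, so
  any two edges in the private conflict set of xy conflict with each other. A vertex incident
  with a private edge of xy is neither covered by nor adjacent to the other edges of M.

  For the first part, two private vertices v and w at distance 2 from xy are never adjacent, since
  the edge vw would conflict with no edge of M (\<open>private_far_independent\<close>). Let a be adjacent to x but not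
  to y, let c be adjacent to y but not to x, and let av and cw be edges to such far private vertices.
  They are private edges, hence conflict; so a and c are adjacent or have a common neighbour z among
  v and w. In the second case a non-adjacent pair would yield the induced 5-cycle x, a, z, c, y.
  Therefore a and c are always adjacent (\<open>private_near_complete\<close>). Taking for the three integers the
  numbers of neighbours of x only, of both, and of y only that have a far private neighbour, every
  vertex of the first kind has lost one edge to x and one to each vertex of the last kind,
  symmetrically for the last kind, and a vertex of the second kind has lost its edges to x and y;
  the bound is the sum of the remaining degrees (\<open>private_crossing_edges_bound\<close>).

  For the second part, charge each edge of G twice: to two conflict sets containing it, or, if there
  is only one, to that set and to its private part. Hence twice the number of edges is at most the sum
  over M of the sizes of conflict set and private conflict set (\<open>twice_edges_le_sum\<close>), and it remains
  to bound each summand by 3d^2 - 2d + 1. Both sets consist of edges at x or y, edges inside the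
  neighbourhood of xy and edges leaving it. Counting the last ones for the private conflict set
  by the first part, and all the others by a degree sum over the neighbourhood, gives the bound
  (\<open>conflict_plus_private_bound\<close>).
\<close>

section \<open>Conflicts between edges\<close>

definition conflicting :: "'a ugraph \<Rightarrow> 'a set \<Rightarrow> 'a set \<Rightarrow> bool" where
  "conflicting G e f \<longleftrightarrow> (\<exists>u \<in> e. \<exists>v \<in> f. u = v \<or> {u, v} \<in> edges G)"

lemma conflicting_sym: "conflicting G e f \<longleftrightarrow> conflicting G f e"
  unfolding conflicting_def by (metis insert_commute)

lemma edge_card: "finite_simple_graph G \<Longrightarrow> e \<in> edges G \<Longrightarrow> card e = 2"
  and edge_sub: "finite_simple_graph G \<Longrightarrow> e \<in> edges G \<Longrightarrow> e \<subseteq> verts G"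
  by (auto simp: finite_simple_graph_def)

lemma finite_edges: "finite_simple_graph G \<Longrightarrow> finite (edges G)"
  unfolding finite_simple_graph_def
  by (metis PowI finite_Pow_iff finite_subset subsetI)

lemma conflicting_refl: "finite_simple_graph G \<Longrightarrow> e \<in> edges G \<Longrightarrow> conflicting G e e"
  using edge_card[of G e] by (cases "e = {}") (auto simp: conflicting_def)

lemma edge_obtain:
  assumes "finite_simple_graph G" "e \<in> edges G" "u \<in> e"
  obtains v where "e = {u, v}" "v \<noteq> u" "v \<in> nbhd G u" "u \<in> nbhd G v"
proof -
  have "card e = 2" using assms edge_card by blast
  then obtain v where v: "e = {u, v}" "v \<noteq> u"
    using assms(3) by (auto simp: card_2_iff doubleton_eq_iff)
  moreover have "v \<in> nbhd G u" "u \<in> nbhd G v"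
    using v assms edge_sub[OF assms(1,2)] by (auto simp: nbhd_def insert_commute)
  ultimately show ?thesis using that by blast
qed

lemma nbhd_iff:
  assumes "finite_simple_graph G"
  shows "v \<in> nbhd G u \<longleftrightarrow> {u, v} \<in> edges G"
  using edge_sub[OF assms] by (auto simp: nbhd_def)

lemma not_loop: "finite_simple_graph G \<Longrightarrow> {u, u} \<notin> edges G"
  using edge_card[of G "{u, u}"] by auto

text \<open>
  The distance is an infimum of extended naturals. These are well-ordered, so a finite distance is
  attained by a walk; only the absence of any walk gives infinity.
\<close>

lemma walk_of_length_le_2:
  assumes "graph_dist H e f \<le> 2"
  obtains p where "walk_betw H e p f" "length p \<le> 3"
proof -
  let ?W = "{p. walk_betw H e p f}"
  have ne: "?W \<noteq> {}"
  proof
    assume "?W = {}"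
    then have "graph_dist H e f = \<infinity>"
      by (simp only: graph_dist_def image_empty Inf_enat_def) simp
    with assms show False by simp
  qed
  then have "(INF p\<in>?W. enat (length p - 1)) \<in> (\<lambda>p. enat (length p - 1)) ` ?W"
    unfolding Inf_enat_def by (auto intro: LeastI)
  then obtain p where "walk_betw H e p f" "graph_dist H e f = enat (length p - 1)"
    unfolding graph_dist_def by auto
  with assms have "length p - 1 \<le> 2"
    by (metis enat_ord_simps(1) numeral_eq_enat)
  with \<open>walk_betw H e p f\<close> that[of p] show ?thesis by auto
qed

lemma graph_dist_le:
  assumes "walk_betw H e p f" "length p \<le> 3"
  shows "graph_dist H e f \<le> 2"
proof -
  have "graph_dist H e f \<le> enat (length p - 1)"
    unfolding graph_dist_def using assms(1) by (auto intro: INF_lower2)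
  also have "\<dots> \<le> 2" using assms(2) by (simp add: numeral_eq_enat)
  finally show ?thesis .
qed

lemma line_graph_adj:
  "{e, f} \<in> edges (line_graph G) \<longleftrightarrow>
     e \<in> edges G \<and> f \<in> edges G \<and> e \<noteq> f \<and> e \<inter> f \<noteq> {}"
  unfolding line_graph_def by (auto simp: doubleton_eq_iff)

text \<open>
  A walk of length 2 in the line graph from e to f passes through one edge b meeting both. Picking
  a vertex of b in e and one in f gives either the same vertex or the two ends of b. This turns
  distances in the line graph into adjacency in G.
\<close>

lemma conflict_set_iff:
  assumes G: "finite_simple_graph G" and e: "e \<in> edges G"
  shows "f \<in> conflict_set G e \<longleftrightarrow> f \<in> edges G \<and> conflicting G e f"
proof
  assume "f \<in> conflict_set G e"
  then have f: "f \<in> edges G" and "graph_dist (line_graph G) e f \<le> 2"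
    by (auto simp: conflict_set_def)
  from walk_of_length_le_2[OF this(2)] obtain p where
    p: "walk_betw (line_graph G) e p f" and len: "length p \<le> 3" by blast
  consider a where "p = [a]" | a b where "p = [a, b]" | a b c where "p = [a, b, c]"
    using p len by (auto simp: walk_betw_def length_Suc_conv numeral_eq_Suc le_Suc_eq)
  then have "conflicting G e f"
  proof cases
    case 1
    then have "e = f" using p by (auto simp: walk_betw_def)
    moreover have "e \<noteq> {}" using edge_card[OF G e] by auto
    ultimately show ?thesis by (auto simp: conflicting_def)
  next
    case 2
    then have "e \<inter> f \<noteq> {}" using p by (auto simp: walk_betw_def line_graph_adj)
    then show ?thesis by (auto simp: conflicting_def)
  next
    case 3
    then have b: "b \<in> edges G" "e \<inter> b \<noteq> {}" "b \<inter> f \<noteq> {}"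
      using p by (auto simp: walk_betw_def line_graph_adj)
    then obtain u v where uv: "u \<in> e" "u \<in> b" "v \<in> b" "v \<in> f" by auto
    from edge_obtain[OF G b(1) uv(2)] obtain w where "b = {u, w}" by blast
    with uv b(1) have "u = v \<or> {u, v} \<in> edges G" by auto
    with uv show ?thesis by (auto simp: conflicting_def)
  qed
  with f show "f \<in> edges G \<and> conflicting G e f" ..
next
  assume "f \<in> edges G \<and> conflicting G e f"
  then obtain u v where f: "f \<in> edges G" and uv: "u \<in> e" "v \<in> f" "u = v \<or> {u, v} \<in> edges G"
    by (auto simp: conflicting_def)
  have vs: "verts (line_graph G) = edges G" by (simp add: line_graph_def)
  \<comment> \<open>Consecutive vertices of a walk in the line graph are distinct, while the edge uv may be e or f
    itself; so the cases in which e and f coincide or meet need shorter walks.\<close>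
  have "\<exists>p. walk_betw (line_graph G) e p f \<and> length p \<le> 3"
  proof (cases "e = f")
    case True
    then show ?thesis using e by (intro exI[of _ "[e]"]) (auto simp: walk_betw_def vs)
  next
    case ne: False
    show ?thesis
    proof (cases "e \<inter> f = {}")
      case False
      then show ?thesis using e f ne
        by (intro exI[of _ "[e, f]"]) (auto simp: walk_betw_def vs line_graph_adj)
    next
      case True
      then have "{u, v} \<in> edges G" "{u, v} \<noteq> e" "{u, v} \<noteq> f" using uv by auto
      then show ?thesis using e f uv
        by (intro exI[of _ "[e, {u, v}, f]"]) (auto simp: walk_betw_def vs line_graph_adj)
    qed
  qed
  then show "f \<in> conflict_set G e"
    using f graph_dist_le by (auto simp: conflict_set_def)
qed

text \<open>
  Being 1-regular on the covered vertices is the same as pairwise absence of conflicts. This is the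
  form in which additions and swaps can be checked edge by edge.
\<close>

lemma induced_matching_iff:
  assumes G: "finite_simple_graph G"
  shows "induced_matching G M \<longleftrightarrow>
    M \<subseteq> edges G \<and> (\<forall>e \<in> M. \<forall>f \<in> M. e \<noteq> f \<longrightarrow> \<not> conflicting G e f)"
proof
  assume im: "induced_matching G M"
  then have sub: "M \<subseteq> edges G" and
    deg: "\<And>u. u \<in> \<Union>M \<Longrightarrow> card (nbhd (induced_subgraph G (\<Union>M)) u) = 1"
    by (auto simp: induced_matching_def regular_def degree_def induced_subgraph_def)
  have uniq: "v = w" if uvw: "u \<in> \<Union>M" "v \<in> \<Union>M" "w \<in> \<Union>M"
    "{u, v} \<in> edges G" "{u, w} \<in> edges G" for u v w
  proof -
    obtain z where "nbhd (induced_subgraph G (\<Union>M)) u = {z}"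
      using deg[OF uvw(1)] by (metis card_1_singletonE)
    moreover have "v \<in> nbhd (induced_subgraph G (\<Union>M)) u" "w \<in> nbhd (induced_subgraph G (\<Union>M)) u"
      using uvw edge_sub[OF G] by (auto simp: nbhd_def induced_subgraph_def)
    ultimately show ?thesis by simp
  qed
  have eq: "e = f" if ef: "e \<in> M" "f \<in> M" "u \<in> e" "u \<in> f" for e f u
  proof -
    obtain v where v: "e = {u, v}" using edge_obtain[OF G _ ef(3)] ef(1) sub by blast
    obtain w where w: "f = {u, w}" using edge_obtain[OF G _ ef(4)] ef(2) sub by blast
    have "v = w" using v w ef(1,2) sub by (intro uniq[of u]) auto
    with v w show ?thesis by simp
  qed
  have "e = f" if ef: "e \<in> M" "f \<in> M" and c: "conflicting G e f" for e f
  proof -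
    from c obtain u v where uv: "u \<in> e" "v \<in> f" "u = v \<or> {u, v} \<in> edges G"
      by (auto simp: conflicting_def)
    obtain w where w: "e = {u, w}" using edge_obtain[OF G _ uv(1)] ef(1) sub by blast
    have "u = v \<or> w = v" using uniq[of u w v] uv w ef sub by auto
    then show ?thesis using eq ef uv w by blast
  qed
  with sub show "M \<subseteq> edges G \<and> (\<forall>e \<in> M. \<forall>f \<in> M. e \<noteq> f \<longrightarrow> \<not> conflicting G e f)" by blast
next
  assume *: "M \<subseteq> edges G \<and> (\<forall>e \<in> M. \<forall>f \<in> M. e \<noteq> f \<longrightarrow> \<not> conflicting G e f)"
  then have sub: "M \<subseteq> edges G" and
    disj: "\<And>e f. e \<in> M \<Longrightarrow> f \<in> M \<Longrightarrow> conflicting G e f \<Longrightarrow> e = f" by auto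
  have "card (nbhd (induced_subgraph G (\<Union>M)) u) = 1" if u: "u \<in> \<Union>M" for u
  proof -
    from u obtain e where e: "e \<in> M" "u \<in> e" by auto
    obtain v where v: "e = {u, v}" "v \<noteq> u"
      using edge_obtain[OF G subsetD[OF sub e(1)] e(2)] by metis
    have "w = v" if "{u, w} \<in> edges G" "w \<in> f" "f \<in> M" for w f
    proof -
      have "conflicting G e f" using that e by (auto simp: conflicting_def)
      then have "f = e" using disj[of e f] e that by simp
      with that v not_loop[OF G] show ?thesis by auto
    qed
    then have "nbhd (induced_subgraph G (\<Union>M)) u = {v}"
      using v e sub edge_sub[OF G subsetD[OF sub e(1)]]
      by (auto simp: nbhd_def induced_subgraph_def)
    then show ?thesis by simp
  qed
  with * show "induced_matching G M"
    by (auto simp: induced_matching_def regular_def degree_def induced_subgraph_def)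
qed

section \<open>Local optima\<close>

lemma local_search_output_induced_matching:
  assumes "local_search_output G M"
  shows "induced_matching G M"
proof -
  have "induced_matching G {}"
    by (simp add: induced_matching_def regular_def induced_subgraph_def)
  moreover have "induced_matching G M'" if "ls_iteration G M M'" "induced_matching G M" for M M'
    using that by (auto simp: ls_iteration_def perform_if_possible_def ls_add_def ls_swap_def)
  ultimately have "(ls_iteration G)\<^sup>*\<^sup>* {} M \<Longrightarrow> induced_matching G M"
    by - (erule rtranclp_induct, auto)
  then show ?thesis using assms by (simp add: local_search_output_def)
qed

text \<open>
  An edge in conflict with no matching edge could be added.
\<close>

lemma local_search_output_dominates:
  assumes G: "finite_simple_graph G" and out: "local_search_output G M" and e: "e \<in> edges G"
  shows "\<exists>f \<in> M. conflicting G f e"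
proof (rule ccontr)
  assume no: "\<not> ?thesis"
  have im: "induced_matching G M" by (rule local_search_output_induced_matching[OF out])
  have "conflicting G e e" by (rule conflicting_refl[OF G e])
  with no have "e \<notin> M" by blast
  moreover have "induced_matching G (M \<union> {e})"
    using im no e conflicting_sym[of G] unfolding induced_matching_iff[OF G] by blast
  ultimately have "ls_add G M (M \<union> {e})" using e by (auto simp: ls_add_def)
  with out show False by (auto simp: local_search_output_def)
qed

lemma private_conflict_set_iff:
  assumes G: "finite_simple_graph G" and "M \<subseteq> edges G" "e \<in> M"
  shows "f \<in> private_conflict_set G M e \<longleftrightarrow>
    f \<in> edges G \<and> conflicting G e f \<and> (\<forall>g \<in> M - {e}. \<not> conflicting G g f)"
proof -
  have "f \<in> conflict_set G g \<longleftrightarrow> f \<in> edges G \<and> conflicting G g f" if "g \<in> M" for g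
    by (rule conflict_set_iff[OF G subsetD[OF assms(2) that]])
  then show ?thesis unfolding private_conflict_set_def using assms(3) by auto
qed

text \<open>
  Two private edges of e without mutual conflict could replace e in the matching, because neither of
  them conflicts with any other matching edge.
\<close>

lemma private_conflicts_conflict:
  assumes G: "finite_simple_graph G" and out: "local_search_output G M" and e: "e \<in> M"
    and f: "f \<in> private_conflict_set G M e" and g: "g \<in> private_conflict_set G M e"
  shows "conflicting G f g"
proof (rule ccontr)
  assume no: "\<not> ?thesis"
  have im: "induced_matching G M" by (rule local_search_output_induced_matching[OF out])
  then have sub: "M \<subseteq> edges G" by (simp add: induced_matching_def)
  note f = f[unfolded private_conflict_set_iff[OF G sub e]]
  note g = g[unfolded private_conflict_set_iff[OF G sub e]]
  note refl = conflicting_refl[OF G]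
  \<comment> \<open>A matching edge other than e conflicts with itself and so is not private; and e conflicts with
    both f and g.\<close>
  have "f \<noteq> e" using g no by auto
  moreover have "g \<noteq> e" using f no conflicting_sym[of G f g] by auto
  ultimately have fM: "f \<in> edges G - M" and gM: "g \<in> edges G - M" using f g refl by auto
  have fg: "f \<noteq> g" using no f refl by auto
  have new: "induced_matching G ((M - {e}) \<union> {f, g})"
  proof -
    have "\<not> conflicting G g f" using no conflicting_sym[of G f g] by simp
    moreover have "\<not> conflicting G f h" "\<not> conflicting G g h" if "h \<in> M - {e}" for h
      using that f g conflicting_sym[of G h] by auto
    ultimately show ?thesis
      using im no f g unfolding induced_matching_iff[OF G] by auto
  qed
  have "ls_swap G M ((M - {e}) \<union> {f, g})"
    unfolding ls_swap_def
    by (rule bexI[OF _ e], rule bexI[OF _ fM], rule bexI[OF _ gM])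
      (use fg new in simp)
  with out show False by (auto simp: local_search_output_def)
qed

lemma induced_C5:
  assumes "distinct [v0, v1, v2, v3, v4]" "{v0, v1, v2, v3, v4} \<subseteq> verts G"
    and "{v0, v1} \<in> edges G" "{v1, v2} \<in> edges G" "{v2, v3} \<in> edges G" "{v3, v4} \<in> edges G"
        "{v4, v0} \<in> edges G"
    and "{v0, v2} \<notin> edges G" "{v1, v3} \<notin> edges G" "{v2, v4} \<notin> edges G" "{v3, v0} \<notin> edges G"
        "{v4, v1} \<notin> edges G"
    and G: "finite_simple_graph G"
  shows "\<not> induced_free (cycle_graph 5) G"
proof -
  let ?S = "{v0, v1, v2, v3, v4}"
  define f :: "'a \<Rightarrow> nat" where
    "f u = (if u = v0 then 0 else if u = v1 then 1 else if u = v2 then 2 else if u = v3 then 3 else 4)"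
    for u
  have f: "f v0 = 0" "f v1 = 1" "f v2 = 2" "f v3 = 3" "f v4 = 4"
    using assms(1) by (auto simp: f_def)
  have C: "verts (cycle_graph 5) = {0, 1, 2, 3, 4}"
    "edges (cycle_graph 5) = {{0, 1}, {1, 2}, {2, 3}, {3, 4}, {4, 0}}"
  proof -
    have five: "{..<5} = {0, 1, 2, 3, 4::nat}" by (auto simp: lessThan_nat_numeral lessThan_Suc)
    have "edges (cycle_graph 5) = (\<lambda>i. {i, Suc i mod 5}) ` {..<5}"
      by (auto simp: cycle_graph_def)
    then show "edges (cycle_graph 5) = {{0, 1}, {1, 2}, {2, 3}, {3, 4}, {4, 0}}"
      unfolding five by (simp add: numeral_2_eq_2)
    show "verts (cycle_graph 5) = {0, 1, 2, 3, 4}"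
      unfolding five[symmetric] by (simp add: cycle_graph_def)
  qed
  have "bij_betw f ?S {0, 1, 2, 3, 4}"
    unfolding bij_betw_def inj_on_def by (auto simp: f)
  moreover have "\<forall>u \<in> ?S. \<forall>v \<in> ?S.
      {u, v} \<in> edges (induced_subgraph G ?S) \<longleftrightarrow> {f u, f v} \<in> edges (cycle_graph 5)"
    using assms(3-12) not_loop[OF G]
    by (simp add: f C induced_subgraph_def doubleton_eq_iff insert_commute)
  ultimately have "isomorphic (induced_subgraph G ?S) (cycle_graph 5)"
    unfolding isomorphic_def by (intro exI[of _ f]) (simp add: C induced_subgraph_def)
  with assms(2) show ?thesis unfolding induced_free_def by blast
qed

section \<open>Edges between the private vertices of a matching edge\<close>

text \<open>
  Relative to an edge xy, the edges that conflict with xy but avoid x and y are exactly those with an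
  end in the first of the following two sets, and they stay inside the union of both.
\<close>

definition near :: "'a ugraph \<Rightarrow> 'a \<Rightarrow> 'a \<Rightarrow> 'a set" where
  "near G x y = (nbhd G x \<union> nbhd G y) - {x, y}"

definition far :: "'a ugraph \<Rightarrow> 'a \<Rightarrow> 'a \<Rightarrow> 'a set" where
  "far G x y = verts G - (closed_nbhd G x \<union> closed_nbhd G y)"

text \<open>
  Membership in this set carries over to new edges: an edge that conflicts with e and joins two of
  these vertices is again private. So the vertices, not the edges, are the right thing to track.
\<close>

definition private_verts :: "'a ugraph \<Rightarrow> 'a set set \<Rightarrow> 'a set \<Rightarrow> 'a set" where
  "private_verts G M e = \<Union>(private_conflict_set G M e)"

lemma near_far_iff:
  assumes "finite_simple_graph G"
  shows "u \<in> near G x y \<longleftrightarrow> ({x, u} \<in> edges G \<or> {y, u} \<in> edges G) \<and> u \<noteq> x \<and> u \<noteq> y"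
    and "u \<in> far G x y \<longleftrightarrow>
      u \<in> verts G \<and> u \<noteq> x \<and> u \<noteq> y \<and> {x, u} \<notin> edges G \<and> {y, u} \<notin> edges G"
  using nbhd_iff[OF assms] by (auto simp: near_def far_def closed_nbhd_def)

lemma near_far_disjoint: "near G x y \<inter> far G x y = {}"
  by (auto simp: near_def far_def closed_nbhd_def)

lemma finite_nbhd: "finite_simple_graph G \<Longrightarrow> finite (nbhd G u)"
  by (auto simp: finite_simple_graph_def nbhd_def)

lemma finite_near: "finite_simple_graph G \<Longrightarrow> finite (near G x y)"
  by (auto simp: near_def far_def finite_simple_graph_def nbhd_def)

lemma card_nbhd_le_max_degree:
  assumes G: "finite_simple_graph G"
  shows "card (nbhd G u) \<le> max_degree G"
proof (cases "u \<in> verts G")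
  case True
  then show ?thesis using G unfolding max_degree_def finite_simple_graph_def
    by (intro Max_ge) (auto simp: degree_def)
next
  case False
  then have "nbhd G u = {}" using edge_sub[OF G] by (auto simp: nbhd_def)
  then show ?thesis by simp
qed

text \<open>
  A vertex of a matching edge g that equals u or is adjacent to u puts every edge at u into conflict
  with g.
\<close>

lemma private_vert_not_adjacent:
  assumes G: "finite_simple_graph G" and M: "M \<subseteq> edges G" "e \<in> M"
    and u: "u \<in> private_verts G M e" and g: "g \<in> M - {e}" "z \<in> g"
  shows "z \<noteq> u" "{z, u} \<notin> edges G"
proof -
  from u obtain f where "f \<in> private_conflict_set G M e" "u \<in> f" by (auto simp: private_verts_def)
  then have "\<not> conflicting G g f" "u \<in> f" using g private_conflict_set_iff[OF G M] by auto
  then show "z \<noteq> u" "{z, u} \<notin> edges G" using g by (auto simp: conflicting_def)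
qed

text \<open>
  An edge vw between such vertices would conflict with no matching edge at all: not with xy, since v
  and w are at distance at least 2 from x and y, and not with another one, since v and w are private.
  A maximal matching leaves no such edge.
\<close>

lemma private_far_independent:
  assumes G: "finite_simple_graph G" and out: "local_search_output G M" and M: "{x, y} \<in> M"
    and v: "v \<in> far G x y \<inter> private_verts G M {x, y}"
    and w: "w \<in> far G x y \<inter> private_verts G M {x, y}"
  shows "{v, w} \<notin> edges G"
proof
  assume "{v, w} \<in> edges G"
  then obtain f where f: "f \<in> M" "conflicting G f {v, w}"
    using local_search_output_dominates[OF G out] by blast
  then obtain z t where z: "z \<in> f" "t = v \<or> t = w" "z = t \<or> {z, t} \<in> edges G"
    by (auto simp: conflicting_def)
  have sub: "M \<subseteq> edges G"
    using local_search_output_induced_matching[OF out] by (simp add: induced_matching_def)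
  show False
  proof (cases "f = {x, y}")
    case True
    then show False using z v w near_far_iff(2)[OF G] by auto
  next
    case False
    then have "f \<in> M - {{x, y}}" using f by simp
    moreover have "t \<in> private_verts G M {x, y}" using z v w by auto
    ultimately show False using private_vert_not_adjacent[OF G sub M] z by metis
  qed
qed

text \<open>
  Applied with v far from xy, this makes all edges between near and far private vertices private,
  not only those that witness that their ends are private vertices.
\<close>

lemma edge_between_private_verts:
  assumes G: "finite_simple_graph G" and M: "M \<subseteq> edges G" "{x, y} \<in> M"
    and u: "u \<in> near G x y \<inter> private_verts G M {x, y}" and v: "v \<in> private_verts G M {x, y}"
    and uv: "{u, v} \<in> edges G"
  shows "{u, v} \<in> private_conflict_set G M {x, y}"
proof -
  have "conflicting G {x, y} {u, v}" using u near_far_iff(1)[OF G] by (auto simp: conflicting_def)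
  moreover have "\<not> conflicting G g {u, v}" if g: "g \<in> M - {{x, y}}" for g
    using private_vert_not_adjacent[OF G M _ g] u v unfolding conflicting_def by blast
  ultimately show ?thesis using uv private_conflict_set_iff[OF G M] by auto
qed

text \<open>
  Here both optimality and the forbidden cycle enter. The edges av and cw are private, so they
  conflict. If a and c are not adjacent, then, as v and w are not adjacent either, the conflict gives
  a common far neighbour z of a and c, and x, a, z, c, y is an induced cycle of order 5.
\<close>

lemma private_near_complete:
  assumes G: "finite_simple_graph G" and C5: "induced_free (cycle_graph 5) G"
    and out: "local_search_output G M" and M: "{x, y} \<in> M"
    and a: "a \<in> near G x y \<inter> private_verts G M {x, y}" "{y, a} \<notin> edges G"
    and c: "c \<in> near G x y \<inter> private_verts G M {x, y}" "{x, c} \<notin> edges G"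
    and v: "v \<in> far G x y \<inter> private_verts G M {x, y}" "{a, v} \<in> edges G"
    and w: "w \<in> far G x y \<inter> private_verts G M {x, y}" "{c, w} \<in> edges G"
  shows "{a, c} \<in> edges G"
proof (rule ccontr)
  assume ac: "{a, c} \<notin> edges G"
  have sub: "M \<subseteq> edges G"
    using local_search_output_induced_matching[OF out] by (simp add: induced_matching_def)
  then have xy: "{x, y} \<in> edges G" using M by auto
  have "conflicting G {a, v} {c, w}"
    using edge_between_private_verts[OF G sub M a(1) _ v(2)] v(1)
      edge_between_private_verts[OF G sub M c(1) _ w(2)] w(1)
    by (intro private_conflicts_conflict[OF G out M]) auto
  moreover have "{v, w} \<notin> edges G" by (rule private_far_independent[OF G out M v(1) w(1)])
  moreover have "a \<noteq> c" using a c near_far_iff(1)[OF G] by auto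
  moreover have "a \<noteq> w" "v \<noteq> c" using a c v w near_far_disjoint[of G x y] by auto
  ultimately have "v = w \<or> {a, w} \<in> edges G \<or> {v, c} \<in> edges G"
    using ac by (auto simp: conflicting_def)
  then obtain z where z: "z \<in> far G x y" "{a, z} \<in> edges G" "{z, c} \<in> edges G"
    using v w by (auto simp: insert_commute)
  have adj: "{x, a} \<in> edges G" "{c, y} \<in> edges G" and ne: "a \<noteq> x" "a \<noteq> y" "c \<noteq> x" "c \<noteq> y"
    using a c near_far_iff(1)[OF G] by (auto simp: insert_commute)
  have "\<not> induced_free (cycle_graph 5) G"
  proof (rule induced_C5[where ?v0.0 = x and ?v1.0 = a and ?v2.0 = z and ?v3.0 = c and ?v4.0 = y])
    have "x \<noteq> y" using xy not_loop[OF G] by auto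
    moreover have "z \<noteq> x" "z \<noteq> y" "z \<noteq> a" "z \<noteq> c"
      using z near_far_iff(2)[OF G] not_loop[OF G] by auto
    ultimately show "distinct [x, a, z, c, y]" using ne \<open>a \<noteq> c\<close> by auto
    show "{x, a, z, c, y} \<subseteq> verts G"
      using edge_sub[OF G xy] edge_sub[OF G z(2)] edge_sub[OF G z(3)] by auto
    show "{x, z} \<notin> edges G" "{z, y} \<notin> edges G"
      using z(1) near_far_iff(2)[OF G] by (auto simp: insert_commute)
  qed (use adj z xy ac a c G in \<open>auto simp: insert_commute\<close>)
  with C5 show False by simp
qed

lemma num_edges_between_le_sum:
  assumes G: "finite_simple_graph G" and "finite X"
  shows "num_edges_between G X Y \<le> (\<Sum>u\<in>X. card (nbhd G u \<inter> Y))"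
proof -
  have "{e \<in> edges G. \<exists>u\<in>X. \<exists>v\<in>Y. e = {u, v}} \<subseteq> (\<Union>u\<in>X. (\<lambda>v. {u, v}) ` (nbhd G u \<inter> Y))"
    using nbhd_iff[OF G] by auto
  then have "num_edges_between G X Y \<le> card (\<Union>u\<in>X. (\<lambda>v. {u, v}) ` (nbhd G u \<inter> Y))"
    unfolding num_edges_between_def using assms finite_nbhd[OF G] by (intro card_mono) auto
  also have "\<dots> \<le> (\<Sum>u\<in>X. card ((\<lambda>v. {u, v}) ` (nbhd G u \<inter> Y)))"
    by (rule card_UN_le[OF assms(2)])
  also have "\<dots> \<le> (\<Sum>u\<in>X. card (nbhd G u \<inter> Y))"
    using finite_nbhd[OF G] by (intro sum_mono card_image_le) auto
  finally show ?thesis .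
qed

text \<open>
  Only the near vertices with a far private neighbour contribute. Let A, B, C be those adjacent to x
  only, to both, and to y only; their sizes are the three integers. A vertex of A spends one edge on
  x and, since A and C are completely joined, one on every vertex of C; a vertex of C behaves
  symmetrically, and a vertex of B spends two edges on x and y. What is left of the degree d bounds
  the number of far private neighbours.
\<close>

lemma private_crossing_edges_bound:
  fixes G :: "'a ugraph"
  assumes G: "finite_simple_graph G" and C5: "induced_free (cycle_graph 5) G"
    and out: "local_search_output G M" and M: "{x, y} \<in> M"
    and deg: "\<And>u. card (nbhd G u) \<le> d"
  defines "N1 \<equiv> near G x y \<inter> private_verts G M {x, y}"
    and "N2 \<equiv> far G x y \<inter> private_verts G M {x, y}"
  shows "\<exists>dx dxy dy :: int. dx \<ge> 0 \<and> dxy \<ge> 0 \<and> dy \<ge> 0 \<and>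
    dx + dxy \<le> int d - 1 \<and> dy + dxy \<le> int d - 1 \<and> dxy \<le> int (num_common_nbrs G x y) \<and>
    int (num_edges_between G N1 N2)
      \<le> (int d - 1 - dy) * dx + (int d - 2) * dxy + (int d - 1 - dx) * dy"
proof -
  have sub: "M \<subseteq> edges G"
    using local_search_output_induced_matching[OF out] by (simp add: induced_matching_def)
  then have xy: "{x, y} \<in> edges G" using M by auto
  then have xny: "x \<noteq> y" using not_loop[OF G] by auto
  define S where "S = {u \<in> N1. nbhd G u \<inter> N2 \<noteq> {}}"
  define A where "A = S - nbhd G y"
  define B where "B = S \<inter> nbhd G x \<inter> nbhd G y"
  define C where "C = S - nbhd G x"
  note fn = finite_nbhd[OF G] and nb = nbhd_iff[OF G]
  have S_near: "S \<subseteq> near G x y" by (auto simp: S_def N1_def)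
  then have finS: "finite S" by (rule finite_subset[OF _ finite_near[OF G]])
  have S: "S = A \<union> B \<union> C" using S_near by (auto simp: A_def B_def C_def near_def)
  have disj: "A \<inter> B = {}" "(A \<union> B) \<inter> C = {}" "B \<inter> C = {}"
    using S_near by (auto simp: A_def B_def C_def near_def)
  have fin: "finite A" "finite B" "finite C" using finS by (auto simp: A_def B_def C_def)
  have AB: "A \<union> B \<subseteq> nbhd G x - {y}" and BC: "B \<union> C \<subseteq> nbhd G y - {x}"
    using S_near by (auto simp: A_def B_def C_def near_def)
  have "card A + card B = card (A \<union> B)" using fin disj by (simp add: card_Un_disjoint)
  also have "\<dots> \<le> card (nbhd G x - {y})" using AB fn by (intro card_mono) auto
  also have "\<dots> = card (nbhd G x) - 1" using xy nb fn by (simp add: card_Diff_singleton)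
  finally have cAB: "card A + card B \<le> card (nbhd G x) - 1" .
  have "card B + card C = card (B \<union> C)" using fin disj by (simp add: card_Un_disjoint)
  also have "\<dots> \<le> card (nbhd G y - {x})" using BC fn by (intro card_mono) auto
  also have "\<dots> = card (nbhd G y) - 1"
    using xy nb fn by (simp add: card_Diff_singleton insert_commute)
  finally have cBC: "card B + card C \<le> card (nbhd G y) - 1" .
  have pos: "card (nbhd G x) > 0" using xy nb[of y x] fn[of x] by (auto simp: card_gt_0_iff)
  have d: "d \<ge> 1" using pos deg[of x] by simp
  have cB: "card B \<le> num_common_nbrs G x y"
    unfolding num_common_nbrs_def using fn by (intro card_mono) (auto simp: B_def)
  have AC: "c \<in> nbhd G a" "a \<in> nbhd G c" if ac: "a \<in> A" "c \<in> C" for a c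
  proof -
    from ac obtain v w where "v \<in> N2" "{a, v} \<in> edges G" "w \<in> N2" "{c, w} \<in> edges G"
      using nb by (auto simp: A_def C_def S_def)
    moreover have "a \<in> N1" "{y, a} \<notin> edges G" "c \<in> N1" "{x, c} \<notin> edges G"
      using ac nb by (auto simp: A_def C_def S_def)
    ultimately have "{a, c} \<in> edges G"
      using private_near_complete[OF G C5 out M] unfolding N1_def N2_def by blast
    then show "c \<in> nbhd G a" "a \<in> nbhd G c" using nb by (auto simp: insert_commute)
  qed
  have N2: "N2 \<inter> (near G x y \<union> {x, y}) = {}"
    using near_far_disjoint[of G x y] by (auto simp: N2_def far_def closed_nbhd_def)
  \<comment> \<open>Any set K of neighbours of u outside the far vertices reduces the far degree of u.\<close>
  have rest: "card (nbhd G u \<inter> N2) + card K \<le> d"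
    if K: "K \<subseteq> nbhd G u" "K \<subseteq> near G x y \<union> {x, y}" for u K
  proof -
    have "card (nbhd G u \<inter> N2) + card K = card (nbhd G u \<inter> N2 \<union> K)"
      using K N2 fn finite_subset[OF K(1) fn] by (subst card_Un_disjoint) auto
    also have "\<dots> \<le> card (nbhd G u)" using K fn by (intro card_mono) auto
    finally show ?thesis using deg[of u] by simp
  qed
  have bA: "int (card (nbhd G u \<inter> N2)) \<le> int d - 1 - int (card C)" if u: "u \<in> A" for u
  proof -
    have "card (insert x C) = card C + 1" using fin BC by (subst card_insert_disjoint) auto
    moreover have "x \<in> nbhd G u" using AB u nb by (auto simp: insert_commute)
    then have "insert x C \<subseteq> nbhd G u" "insert x C \<subseteq> near G x y \<union> {x, y}"
      using AC(1)[OF u] S S_near by auto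
    note rest[OF this]
    ultimately show ?thesis by linarith
  qed
  have bC: "int (card (nbhd G u \<inter> N2)) \<le> int d - 1 - int (card A)" if u: "u \<in> C" for u
  proof -
    have "card (insert y A) = card A + 1" using fin AB by (subst card_insert_disjoint) auto
    moreover have "y \<in> nbhd G u" using BC u nb by (auto simp: insert_commute)
    then have "insert y A \<subseteq> nbhd G u" "insert y A \<subseteq> near G x y \<union> {x, y}"
      using AC(2)[OF _ u] S S_near by auto
    note rest[OF this]
    ultimately show ?thesis by linarith
  qed
  have bB: "int (card (nbhd G u \<inter> N2)) \<le> int d - 2" if u: "u \<in> B" for u
  proof -
    have "x \<in> nbhd G u" "y \<in> nbhd G u" using u nb by (auto simp: B_def insert_commute)
    then show ?thesis using rest[of "{x, y}" u] xny by auto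
  qed
  have "num_edges_between G N1 N2 \<le> (\<Sum>u\<in>N1. card (nbhd G u \<inter> N2))"
    by (rule num_edges_between_le_sum[OF G]) (simp add: N1_def finite_near[OF G])
  also have "\<dots> = (\<Sum>u\<in>S. card (nbhd G u \<inter> N2))"
    by (rule sum.mono_neutral_right) (auto simp: S_def N1_def finite_near[OF G])
  finally have "int (num_edges_between G N1 N2) \<le> (\<Sum>u\<in>S. int (card (nbhd G u \<inter> N2)))"
    by (metis of_nat_le_iff of_nat_sum)
  also have "\<dots> = (\<Sum>u\<in>A. int (card (nbhd G u \<inter> N2))) + (\<Sum>u\<in>B. int (card (nbhd G u \<inter> N2)))
      + (\<Sum>u\<in>C. int (card (nbhd G u \<inter> N2)))"
    unfolding S using fin disj by (simp add: sum.union_disjoint)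
  also have "\<dots> \<le> (int d - 1 - int (card C)) * int (card A) + (int d - 2) * int (card B)
      + (int d - 1 - int (card A)) * int (card C)"
    using sum_mono[of A "\<lambda>u. int (card (nbhd G u \<inter> N2))" "\<lambda>_. int d - 1 - int (card C)", OF bA]
      sum_mono[of B "\<lambda>u. int (card (nbhd G u \<inter> N2))" "\<lambda>_. int d - 2", OF bB]
      sum_mono[of C "\<lambda>u. int (card (nbhd G u \<inter> N2))" "\<lambda>_. int d - 1 - int (card A)", OF bC]
    by (simp add: mult.commute)
  finally show ?thesis
    using cAB cBC cB pos d deg[of x] deg[of y]
    by (intro exI[of _ "int (card A)"] exI[of _ "int (card B)"] exI[of _ "int (card C)"]) auto
qed

section \<open>The size of a conflict set\<close>

definition edges_in :: "'a ugraph \<Rightarrow> 'a set \<Rightarrow> 'a set set" where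
  "edges_in G X = {e \<in> edges G. e \<subseteq> X}"

definition edges_across :: "'a ugraph \<Rightarrow> 'a set \<Rightarrow> 'a set \<Rightarrow> 'a set set" where
  "edges_across G X Y = {e \<in> edges G. \<exists>u\<in>X. \<exists>v\<in>Y. e = {u, v}}"

text \<open>
  The edges that have x or y as an end; the edge xy is listed separately, as it belongs to both stars.
\<close>

definition end_edges :: "'a ugraph \<Rightarrow> 'a \<Rightarrow> 'a \<Rightarrow> 'a set set" where
  "end_edges G x y =
     insert {x, y} ((\<lambda>u. {x, u}) ` (nbhd G x - {y}) \<union> (\<lambda>u. {y, u}) ` (nbhd G y - {x}))"

text \<open>
  An edge that conflicts with xy and avoids x and y has an end adjacent to x or y; its other end is
  either near or far.
\<close>

lemma conflicting_cases:
  assumes G: "finite_simple_graph G" and f: "f \<in> edges G" "conflicting G {x, y} f"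
  shows "f \<in> end_edges G x y \<or> f \<in> edges_in G (near G x y) \<or>
    f \<in> edges_across G (near G x y) (far G x y)"
proof (cases "x \<in> f \<or> y \<in> f")
  case True
  then show ?thesis
  proof
    assume "x \<in> f"
    from edge_obtain[OF G f(1) this] obtain t where "f = {x, t}" "t \<in> nbhd G x" by metis
    then show ?thesis by (cases "t = y") (auto simp: end_edges_def)
  next
    assume "y \<in> f"
    from edge_obtain[OF G f(1) this] obtain t where "f = {y, t}" "t \<in> nbhd G y" by metis
    then show ?thesis by (cases "t = x") (auto simp: end_edges_def insert_commute)
  qed
next
  case False
  with f(2) obtain s where s: "s \<in> f" "s \<in> near G x y"
    unfolding conflicting_def near_far_iff(1)[OF G] by auto
  from edge_obtain[OF G f(1) s(1)] obtain t where t: "f = {s, t}" "t \<in> nbhd G s" by metis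
  then have "t \<in> near G x y \<or> t \<in> far G x y"
    using False edge_sub[OF G f(1)] near_far_iff[OF G] by auto
  then show ?thesis using s t f(1) by (auto simp: edges_in_def edges_across_def)
qed

lemma finite_end_edges: "finite_simple_graph G \<Longrightarrow> finite (end_edges G x y)"
  by (simp add: end_edges_def finite_nbhd)

lemma finite_edges_in: "finite_simple_graph G \<Longrightarrow> finite (edges_in G X)"
  and finite_edges_across: "finite_simple_graph G \<Longrightarrow> finite (edges_across G X Y)"
  by (simp_all add: edges_in_def edges_across_def finite_edges)

lemma card_end_edges:
  assumes G: "finite_simple_graph G"
  shows "card (end_edges G x y) \<le> 1 + card (nbhd G x - {y}) + card (nbhd G y - {x})"
proof -
  let ?P = "(\<lambda>u. {x, u}) ` (nbhd G x - {y})" and ?Q = "(\<lambda>u. {y, u}) ` (nbhd G y - {x})"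
  have "card (end_edges G x y) \<le> 1 + card (?P \<union> ?Q)"
    unfolding end_edges_def using finite_nbhd[OF G] by (simp add: card_insert_if)
  also have "card (?P \<union> ?Q) \<le> card ?P + card ?Q" by (rule card_Un_le)
  also have "\<dots> \<le> card (nbhd G x - {y}) + card (nbhd G y - {x})"
    using finite_nbhd[OF G] by (intro add_mono card_image_le) auto
  finally show ?thesis by simp
qed

lemma card_conflict_set_le:
  assumes G: "finite_simple_graph G" and xy: "{x, y} \<in> edges G"
  shows "card (conflict_set G {x, y}) \<le> card (end_edges G x y)
    + card (edges_in G (near G x y)) + card (edges_across G (near G x y) (far G x y))"
proof -
  let ?I = "edges_in G (near G x y)" and ?O = "edges_across G (near G x y) (far G x y)"
  have "conflict_set G {x, y} \<subseteq> end_edges G x y \<union> ?I \<union> ?O"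
    using conflicting_cases[OF G] conflict_set_iff[OF G xy] by blast
  then have "card (conflict_set G {x, y}) \<le> card (end_edges G x y \<union> ?I \<union> ?O)"
    using G by (intro card_mono) (auto simp: finite_end_edges finite_edges_in finite_edges_across)
  also have "\<dots> \<le> card (end_edges G x y) + card ?I + card ?O"
    by (meson add_le_mono1 card_Un_le order_trans)
  finally show ?thesis .
qed

text \<open>
  Of the edges leaving the neighbourhood, only those between private vertices can be private; these
  are the ones controlled by the crossing bound. For the remaining edges the bounds of the full
  conflict set are good enough.
\<close>

lemma card_private_conflict_set_le:
  assumes G: "finite_simple_graph G" and M: "M \<subseteq> edges G" "{x, y} \<in> M"
  defines "V \<equiv> private_verts G M {x, y}"
  shows "card (private_conflict_set G M {x, y}) \<le> card (end_edges G x y)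
    + card (edges_in G (near G x y)) + num_edges_between G (near G x y \<inter> V) (far G x y \<inter> V)"
proof -
  let ?I = "edges_in G (near G x y)" and ?O = "edges_across G (near G x y \<inter> V) (far G x y \<inter> V)"
  have "f \<in> end_edges G x y \<union> ?I \<union> ?O" if f: "f \<in> private_conflict_set G M {x, y}" for f
  proof -
    have "f \<subseteq> V" using f by (auto simp: V_def private_verts_def)
    moreover have "f \<in> edges G" "conflicting G {x, y} f"
      using f private_conflict_set_iff[OF G M] by auto
    note conflicting_cases[OF G this]
    ultimately show ?thesis by (auto simp: edges_across_def)
  qed
  then have "card (private_conflict_set G M {x, y}) \<le> card (end_edges G x y \<union> ?I \<union> ?O)"
    using G by (intro card_mono) (auto simp: finite_end_edges finite_edges_in finite_edges_across)
  also have "\<dots> \<le> card (end_edges G x y) + card ?I + card ?O"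
    by (meson add_le_mono1 card_Un_le order_trans)
  also have "card ?O = num_edges_between G (near G x y \<inter> V) (far G x y \<inter> V)"
    by (simp add: edges_across_def num_edges_between_def)
  finally show ?thesis .
qed

text \<open>
  Count pairs of a vertex u of X and an edge at u: an edge inside X is counted twice, an edge between
  X and Y once. As Z avoids X and Y, none of these edges leads from u to Z.
\<close>

lemma degree_sum_bound:
  assumes G: "finite_simple_graph G" and X: "finite X" "X \<inter> Y = {}"
    and Z: "Z \<inter> (X \<union> Y) = {}"
  shows "2 * card (edges_in G X) + card (edges_across G X Y) \<le> (\<Sum>u\<in>X. card (nbhd G u - Z))"
proof -
  let ?I = "edges_in G X" and ?O = "edges_across G X Y"
  have fin: "finite ?I" "finite ?O" using G by (auto simp: finite_edges_in finite_edges_across)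
  have IO: "?I \<inter> ?O = {}" using X(2) by (auto simp: edges_in_def edges_across_def)
  have count: "card {b \<in> F. P b} = (\<Sum>b\<in>F. if P b then 1 else 0)"
    if "finite F" for F :: "'b set" and P
    using that by (simp add: sum.If_cases Collect_conj_eq)
  have "2 * card ?I = (\<Sum>e\<in>?I. card {u \<in> X. u \<in> e})"
  proof -
    have "card {u \<in> X. u \<in> e} = 2" if "e \<in> ?I" for e
    proof -
      have "{u \<in> X. u \<in> e} = e" "e \<in> edges G" using that by (auto simp: edges_in_def)
      then show ?thesis using edge_card[OF G] by simp
    qed
    then show ?thesis by simp
  qed
  moreover have "card ?O \<le> (\<Sum>e\<in>?O. card {u \<in> X. u \<in> e})"
  proof -
    have "1 \<le> card {u \<in> X. u \<in> e}" if "e \<in> ?O" for e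
    proof -
      have "{u \<in> X. u \<in> e} \<noteq> {}" using that by (auto simp: edges_across_def)
      then show ?thesis using X(1) by (simp add: Suc_le_eq card_gt_0_iff)
    qed
    then have "(\<Sum>e\<in>?O. 1) \<le> (\<Sum>e\<in>?O. card {u \<in> X. u \<in> e})" by (rule sum_mono)
    then show ?thesis by simp
  qed
  ultimately have "2 * card ?I + card ?O \<le> (\<Sum>e\<in>?I \<union> ?O. card {u \<in> X. u \<in> e})"
    using fin IO by (simp add: sum.union_disjoint)
  also have "\<dots> = (\<Sum>e\<in>?I \<union> ?O. \<Sum>u\<in>X. if u \<in> e then 1 else 0)"
    by (simp only: count[OF X(1)])
  also have "\<dots> = (\<Sum>u\<in>X. \<Sum>e\<in>?I \<union> ?O. if u \<in> e then 1 else 0)" by (rule sum.swap)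
  also have "\<dots> = (\<Sum>u\<in>X. card {e \<in> ?I \<union> ?O. u \<in> e})"
    using fin by (simp only: count finite_UnI)
  also have "\<dots> \<le> (\<Sum>u\<in>X. card (nbhd G u - Z))"
  proof (rule sum_mono)
    fix u assume u: "u \<in> X"
    have "e \<in> (\<lambda>v. {u, v}) ` (nbhd G u - Z)" if e: "e \<in> ?I \<union> ?O" "u \<in> e" for e
    proof -
      have "e \<in> edges G" "e \<subseteq> X \<union> Y" using e by (auto simp: edges_in_def edges_across_def)
      with edge_obtain[OF G this(1) e(2)] obtain v where "e = {u, v}" "v \<in> nbhd G u" by metis
      with \<open>e \<subseteq> X \<union> Y\<close> Z show ?thesis by auto
    qed
    then have "{e \<in> ?I \<union> ?O. u \<in> e} \<subseteq> (\<lambda>v. {u, v}) ` (nbhd G u - Z)" by blast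
    then show "card {e \<in> ?I \<union> ?O. u \<in> e} \<le> card (nbhd G u - Z)"
      using finite_nbhd[OF G] by (intro surj_card_le) auto
  qed
  finally show ?thesis .
qed

text \<open>
  The numbers p, k, q are the integers of the crossing bound. The values a, n, c stand for the
  numbers of vertices adjacent to x only, to both ends and to y only; I and O1 for the edges inside
  the neighbourhood and those leaving it; O2 for the private ones among the latter. With D = d - 1
  the crossing bound equals D(p + q) - 2pq + (d - 2)k, and D^2 - D(p + q) + 2pq, which is
  (D - p)(D - q) + pq, is nonnegative; so O2 is at most D^2 + (d - 2)n. In total, a neighbour of only
  one end then contributes at most d + 1 and a common neighbour at most 2d; as a common neighbour
  takes up a place at both ends, n = 0 is the extremal case.
\<close>

lemma conflict_polynomial_bound:
  fixes d a c n I O1 O2 p k q :: int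
  assumes "d \<ge> 2" and ac: "a + n \<le> d - 1" "c + n \<le> d - 1"
    and kn: "k \<le> n" and pos: "0 \<le> p" "0 \<le> k" "0 \<le> q"
    and pq: "p + k \<le> d - 1" "q + k \<le> d - 1"
    and deg: "2 * I + O1 \<le> (d - 1) * (a + c) + (d - 2) * n"
    and O2: "O2 \<le> (d - 1 - q) * p + (d - 2) * k + (d - 1 - p) * q"
  shows "2 * (1 + (a + n) + (c + n)) + 2 * I + O1 + O2 \<le> 3 * d^2 - 2 * d + 1"
proof -
  have "0 \<le> (d - 1 - p) * (d - 1 - q) + p * q" using pos pq by simp
  then have "(d - 1 - q) * p + (d - 1 - p) * q \<le> (d - 1)^2"
    by (simp add: algebra_simps power2_eq_square)
  moreover have "(d - 2) * k \<le> (d - 2) * n" using assms(1) kn by (intro mult_left_mono) auto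
  ultimately have O2: "O2 \<le> (d - 1)^2 + (d - 2) * n" using O2 by linarith
  \<comment> \<open>The summand 2(a + c) counts edges at x and y, the rest comes from the degree sum.\<close>
  have "(d + 1) * (a + c) \<le> (d + 1) * (2 * (d - 1 - n))"
    using assms(1) ac by (intro mult_left_mono) auto
  with deg O2 kn pos(2) show ?thesis by (simp add: algebra_simps power2_eq_square)
qed

text \<open>
  An edge inside the neighbourhood of xy may lie in both sets, but it also takes up two units of the
  degree sum over the neighbourhood; an edge leaving it takes up one unit and is counted once, apart
  from the private ones, whose second count is paid for by the crossing bound.
\<close>

lemma conflict_plus_private_bound:
  fixes G :: "'a ugraph"
  assumes G: "finite_simple_graph G" and C5: "induced_free (cycle_graph 5) G"
    and out: "local_search_output G M" and M: "{x, y} \<in> M"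
    and deg: "\<And>u. card (nbhd G u) \<le> d" and d: "d \<ge> 2"
  shows "int (card (conflict_set G {x, y})) + int (card (private_conflict_set G M {x, y}))
    \<le> 3 * (int d)^2 - 2 * int d + 1"
proof -
  have sub: "M \<subseteq> edges G"
    using local_search_output_induced_matching[OF out] by (simp add: induced_matching_def)
  then have xy: "{x, y} \<in> edges G" using M by auto
  then have xny: "x \<noteq> y" using not_loop[OF G] by auto
  note fn = finite_nbhd[OF G] and nb = nbhd_iff[OF G]
  define A where "A = nbhd G x - insert y (nbhd G y)"
  define B where "B = nbhd G x \<inter> nbhd G y"
  define C where "C = nbhd G y - insert x (nbhd G x)"
  have loop: "x \<notin> nbhd G x" "y \<notin> nbhd G y" using nb not_loop[OF G] by auto
  have xy': "x \<in> nbhd G y" "y \<in> nbhd G x" using xy nb by (auto simp: insert_commute)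
  have near: "near G x y = A \<union> B \<union> C" using loop by (auto simp: near_def A_def B_def C_def)
  have fin: "finite A" "finite B" "finite C" using fn by (auto simp: A_def B_def C_def)
  have disj: "A \<inter> B = {}" "(A \<union> B) \<inter> C = {}" "C \<inter> B = {}" by (auto simp: A_def B_def C_def)
  have "nbhd G x - {y} = A \<union> B" using loop by (auto simp: A_def B_def)
  then have nx: "card (nbhd G x - {y}) = card A + card B"
    using fin disj by (simp add: card_Un_disjoint)
  have "nbhd G y - {x} = C \<union> B" using loop by (auto simp: C_def B_def)
  then have ny: "card (nbhd G y - {x}) = card C + card B"
    using fin disj by (simp add: card_Un_disjoint)
  have minus: "card (nbhd G u - {z}) \<le> d - 1" if "z \<in> nbhd G u" for u z
    using deg[of u] that fn by (simp add: card_Diff_singleton)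
  let ?I = "edges_in G (near G x y)" and ?O = "edges_across G (near G x y) (far G x y)"
  have "2 * card ?I + card ?O \<le> (\<Sum>u\<in>near G x y. card (nbhd G u - {x, y}))"
    by (rule degree_sum_bound[OF G finite_near[OF G] near_far_disjoint])
      (auto simp: near_def far_def closed_nbhd_def)
  also have "\<dots> = (\<Sum>u\<in>A. card (nbhd G u - {x, y})) + (\<Sum>u\<in>B. card (nbhd G u - {x, y}))
      + (\<Sum>u\<in>C. card (nbhd G u - {x, y}))"
    unfolding near using fin disj by (simp add: sum.union_disjoint)
  also have "\<dots> \<le> card A * (d - 1) + card B * (d - 2) + card C * (d - 1)"
  proof (intro add_mono)
    have "card (nbhd G u - {x, y}) \<le> d - 1" if u: "u \<in> A \<union> C" for u
    proof -
      have "x \<in> nbhd G u \<or> y \<in> nbhd G u"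
        using u nb by (auto simp: A_def C_def insert_commute)
      then obtain z where z: "z \<in> {x, y}" "z \<in> nbhd G u" by blast
      then have "card (nbhd G u - {x, y}) \<le> card (nbhd G u - {z})"
        using fn by (intro card_mono) auto
      with minus[OF z(2)] show ?thesis by simp
    qed
    then show "(\<Sum>u\<in>A. card (nbhd G u - {x, y})) \<le> card A * (d - 1)"
      "(\<Sum>u\<in>C. card (nbhd G u - {x, y})) \<le> card C * (d - 1)"
      using sum_bounded_above[of A "\<lambda>u. card (nbhd G u - {x, y})" "d - 1"]
        sum_bounded_above[of C "\<lambda>u. card (nbhd G u - {x, y})" "d - 1"] by auto
    have "card (nbhd G u - {x, y}) \<le> d - 2" if u: "u \<in> B" for u
    proof -
      have "{x, y} \<subseteq> nbhd G u" using u nb by (auto simp: B_def insert_commute)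
      then have "card (nbhd G u - {x, y}) = card (nbhd G u) - 2"
        using xny by (simp add: card_Diff_subset)
      with deg[of u] show ?thesis by simp
    qed
    then show "(\<Sum>u\<in>B. card (nbhd G u - {x, y})) \<le> card B * (d - 2)"
      using sum_bounded_above[of B "\<lambda>u. card (nbhd G u - {x, y})" "d - 2"] by auto
  qed
  finally have "int (2 * card ?I + card ?O)
      \<le> int (card A * (d - 1) + card B * (d - 2) + card C * (d - 1))"
    by (rule of_nat_mono)
  moreover have "int (d - 1) = int d - 1" "int (d - 2) = int d - 2" using d by auto
  ultimately have "2 * int (card ?I) + int (card ?O) \<le> int (card A) * (int d - 1)
      + int (card B) * (int d - 2) + int (card C) * (int d - 1)"
    by (simp only: of_nat_add of_nat_mult of_nat_numeral)
  then have degsum: "2 * int (card ?I) + int (card ?O)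
      \<le> (int d - 1) * (int (card A) + int (card C)) + (int d - 2) * int (card B)"
    by (simp add: algebra_simps)
  define V where "V = private_verts G M {x, y}"
  define m where "m = num_edges_between G (near G x y \<inter> V) (far G x y \<inter> V)"
  obtain p k q :: int where pkq: "p \<ge> 0" "k \<ge> 0" "q \<ge> 0" "p + k \<le> int d - 1" "q + k \<le> int d - 1"
    "k \<le> int (card B)" "int m \<le> (int d - 1 - q) * p + (int d - 2) * k + (int d - 1 - p) * q"
    using private_crossing_edges_bound[OF G C5 out M deg]
    unfolding V_def m_def B_def num_common_nbrs_def by blast
  have "card A + card B \<le> d - 1" "card C + card B \<le> d - 1"
    using minus[OF xy'(1)] minus[OF xy'(2)] nx ny by auto
  then have "2 * (1 + (int (card A) + int (card B)) + (int (card C) + int (card B)))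
      + 2 * int (card ?I) + int (card ?O) + int m \<le> 3 * (int d)^2 - 2 * int d + 1"
    using d pkq degsum by (intro conflict_polynomial_bound[where p = p and k = k and q = q]) auto
  moreover have "int (card (conflict_set G {x, y}) + card (private_conflict_set G M {x, y}))
      \<le> 2 * (1 + (int (card A) + int (card B)) + (int (card C) + int (card B)))
        + 2 * int (card ?I) + int (card ?O) + int m"
  proof -
    have "card (conflict_set G {x, y}) + card (private_conflict_set G M {x, y})
      \<le> (card (end_edges G x y) + card ?I + card ?O) + (card (end_edges G x y) + card ?I + m)"
      unfolding m_def V_def
      by (rule add_mono[OF card_conflict_set_le[OF G xy] card_private_conflict_set_le[OF G sub M]])
    also have "\<dots> = 2 * card (end_edges G x y) + 2 * card ?I + card ?O + m" by simp
    also have "\<dots> \<le> 2 * (1 + (card A + card B) + (card C + card B)) + 2 * card ?I + card ?O + m"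
      using card_end_edges[OF G, of x y] unfolding nx ny by simp
    finally show ?thesis by (simp flip: of_nat_le_iff)
  qed
  ultimately show ?thesis unfolding of_nat_add by (rule order_trans[rotated])
qed

section \<open>The approximation ratio\<close>

text \<open>
  By maximality each edge lies in some conflict set. If it lies in only one, it is private there and is
  counted a second time as such; otherwise it is counted by two conflict sets.
\<close>

lemma twice_edges_le_sum:
  assumes G: "finite_simple_graph G" and out: "local_search_output G M"
  shows "2 * card (edges G) \<le> (\<Sum>f\<in>M. card (conflict_set G f) + card (private_conflict_set G M f))"
proof -
  have sub: "M \<subseteq> edges G"
    using local_search_output_induced_matching[OF out] by (simp add: induced_matching_def)
  have fE: "finite (edges G)" and fM: "finite M"
    using finite_edges[OF G] sub finite_subset by auto
  let ?c = "\<lambda>f e. (if e \<in> conflict_set G f then 1 else 0::nat)"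
  let ?p = "\<lambda>f e. (if e \<in> private_conflict_set G M f then 1 else 0::nat)"
  have "2 \<le> (\<Sum>f\<in>M. ?c f e + ?p f e)" if e: "e \<in> edges G" for e
  proof -
    obtain f where "f \<in> M" "conflicting G f e" using local_search_output_dominates[OF G out e] by blast
    then have f: "f \<in> M" "e \<in> conflict_set G f" using conflict_set_iff[OF G] e sub by auto
    show ?thesis
    proof (cases "e \<in> private_conflict_set G M f")
      case True
      then have "2 \<le> ?c f e + ?p f e" using f by simp
      also have "\<dots> \<le> (\<Sum>f\<in>M. ?c f e + ?p f e)" using f fM by (intro member_le_sum) auto
      finally show ?thesis .
    next
      case False
      then obtain g where g: "g \<in> M - {f}" "e \<in> conflict_set G g"
        using f by (auto simp: private_conflict_set_def)
      have "f \<noteq> g" using g by auto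
      then have "2 \<le> (\<Sum>h\<in>{f, g}. ?c h e + ?p h e)" using f g by simp
      also have "\<dots> \<le> (\<Sum>f\<in>M. ?c f e + ?p f e)" using f g fM by (intro sum_mono2) auto
      finally show ?thesis .
    qed
  qed
  then have "(\<Sum>e\<in>edges G. 2) \<le> (\<Sum>e\<in>edges G. \<Sum>f\<in>M. ?c f e + ?p f e)" by (rule sum_mono)
  also have "\<dots> = (\<Sum>f\<in>M. \<Sum>e\<in>edges G. ?c f e + ?p f e)" by (rule sum.swap)
  also have "\<dots> = (\<Sum>f\<in>M. card (conflict_set G f) + card (private_conflict_set G M f))"
  proof (rule sum.cong[OF refl])
    fix f
    have "edges G \<inter> conflict_set G f = conflict_set G f"
      "edges G \<inter> private_conflict_set G M f = private_conflict_set G M f"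
      by (auto simp: conflict_set_def private_conflict_set_def)
    then show "(\<Sum>e\<in>edges G. ?c f e + ?p f e) =
        card (conflict_set G f) + card (private_conflict_set G M f)"
      using fE by (simp add: sum.distrib sum.If_cases)
  qed
  finally show ?thesis by (simp add: mult.commute)
qed

theorem theorem7:
  fixes G :: "'a ugraph" and d :: nat and M :: "'a set set"
  assumes "d \<ge> 3"
    and "finite_simple_graph G"
    and "induced_free (cycle_graph 5) G"
    and "max_degree G = d"
    and "local_search_output G M"
  shows
    "(\<forall>x y N1 N2.
        {x, y} \<in> M \<longrightarrow>
        N1 = {u \<in> (nbhd G x \<union> nbhd G y) - {x, y}.
                \<exists>e \<in> private_conflict_set G M {x, y}. u \<in> e} \<longrightarrow>
        N2 = {u \<in> verts G - (closed_nbhd G x \<union> closed_nbhd G y).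
                \<exists>e \<in> private_conflict_set G M {x, y}. u \<in> e} \<longrightarrow>
        (\<exists>dx dxy dy :: int.
           dx \<ge> 0 \<and> dxy \<ge> 0 \<and> dy \<ge> 0 \<and>
           dx + dxy \<le> int d - 1 \<and> dy + dxy \<le> int d - 1 \<and>
           dxy \<le> int (num_common_nbrs G x y) \<and>
           int (num_edges_between G N1 N2)
             \<le> (int d - 1 - dy) * dx + (int d - 2) * dxy + (int d - 1 - dx) * dy)) \<and>
     real (card M) \<ge> real (card (edges G)) / (3 / 2 * (real d)^2 - real d + 1 / 2)"
proof (intro conjI allI impI)
  note G = assms(2) and C5 = assms(3) and out = assms(5)
  have deg: "card (nbhd G u) \<le> d" for u using card_nbhd_le_max_degree[OF G] assms(4) by simp
  {
    fix x y N1 N2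
    assume M: "{x, y} \<in> M"
      and N1: "N1 = {u \<in> (nbhd G x \<union> nbhd G y) - {x, y}.
                \<exists>e \<in> private_conflict_set G M {x, y}. u \<in> e}"
      and N2: "N2 = {u \<in> verts G - (closed_nbhd G x \<union> closed_nbhd G y).
                \<exists>e \<in> private_conflict_set G M {x, y}. u \<in> e}"
    have "N1 = near G x y \<inter> private_verts G M {x, y}" "N2 = far G x y \<inter> private_verts G M {x, y}"
      unfolding N1 N2 by (auto simp: near_def far_def private_verts_def)
    then show "\<exists>dx dxy dy :: int.
           dx \<ge> 0 \<and> dxy \<ge> 0 \<and> dy \<ge> 0 \<and>
           dx + dxy \<le> int d - 1 \<and> dy + dxy \<le> int d - 1 \<and>
           dxy \<le> int (num_common_nbrs G x y) \<and>
           int (num_edges_between G N1 N2)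
             \<le> (int d - 1 - dy) * dx + (int d - 2) * dxy + (int d - 1 - dx) * dy"
      using private_crossing_edges_bound[OF G C5 out M deg] by simp
  }
  have sub: "M \<subseteq> edges G"
    using local_search_output_induced_matching[OF out] by (simp add: induced_matching_def)
  have "int (card (conflict_set G f) + card (private_conflict_set G M f))
      \<le> 3 * (int d)^2 - 2 * int d + 1" if f: "f \<in> M" for f
  proof -
    obtain x y where "f = {x, y}" using edge_card[OF G] f sub by (meson card_2_iff subsetD)
    then show ?thesis using conflict_plus_private_bound[OF G C5 out _ deg] f assms(1) by simp
  qed
  then have "(\<Sum>f\<in>M. int (card (conflict_set G f) + card (private_conflict_set G M f)))
      \<le> of_nat (card M) * (3 * (int d)^2 - 2 * int d + 1)"
    by (rule sum_bounded_above)
  moreover have "int (2 * card (edges G))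
      \<le> (\<Sum>f\<in>M. int (card (conflict_set G f) + card (private_conflict_set G M f)))"
    using twice_edges_le_sum[OF G out] by (metis of_nat_le_iff of_nat_sum)
  ultimately have "int (2 * card (edges G)) \<le> int (card M) * (3 * (int d)^2 - 2 * int d + 1)"
    by simp
  then have "real_of_int (int (2 * card (edges G)))
      \<le> real_of_int (int (card M) * (3 * (int d)^2 - 2 * int d + 1))"
    by (simp only: of_int_le_iff)
  then have "real (card (edges G)) \<le> real (card M) * (3 / 2 * (real d)^2 - real d + 1 / 2)"
    by (simp add: algebra_simps)
  moreover have "3 / 2 * (real d)^2 - real d + 1 / 2 > 0"
  proof -
    have "3 / 2 * (real d)^2 - real d + 1 / 2 = (real d)^2 + (real d - 1)^2 / 2"
      by (simp add: power2_eq_square field_simps)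
    also have "\<dots> > 0" using assms(1) by (intro add_pos_nonneg) auto
    finally show ?thesis .
  qed
  ultimately show "real (card M) \<ge> real (card (edges G)) / (3 / 2 * (real d)^2 - real d + 1 / 2)"
    by (simp add: pos_divide_le_eq)
qed

end
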